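(* Let $X$ be an $n$-dimensional (in particular, finite-dimensional) Archimedean pre-Riesz space. Then $X$ is pervasive if and only if $X$ is a vector lattice.
   Context: All vector spaces are real. An ordered vector space $X$ is a real vector space with a cone $X_+$ (closed under addition and multiplication by nonnegative scalars, $X_+\cap(-X_+)=\{0\}$), ordered by $x\le y$ iff $y-x\in X_+$. It is Archimedean if $nx\le y$ for all $n\in\mathbb N$ implies $x\le 0$. A linear subspace $D$ of an ordered vector space $Y$ is order dense in $Y$ if $y=\inf\{z\in D: y\le z\}$ for every $y\in Y$. An ordered vector space $X$ is a pre-Riesz space if there exist a vector lattice $Y$ and a bipositive linear map $i\colon X\to Y$ (i.e. $i(x)\ge 0$ iff $x\ge 0$) such that $i(X)$ is order dense in $Y$; then $(Y,i)$ is called a vector lattice cover of $X$. A pre-Riesz space $X$ is pervasive if for some (equivalently, every) vector lattice cover $(Y,i)$ of $X$, for every $y\in Y_+$ with $y\ne 0$ there is $x\in X$ with $0<i(x)\le y$. *)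

theory Defs
  imports "HOL-Analysis.Analysis" "HOL-Analysis.Finite_Function_Topology"
begin

text \<open>
  An ordered vector space is given by a subspace \<open>V\<close> of some real vector space together with its
  positive cone \<open>C\<close>. The library predicate \<^const>\<open>convex_cone\<close> says that \<open>C\<close> is nonempty and closed
  under addition and nonnegative scaling, see \<open>convex_cone_iff\<close>.
\<close>

definition ordered_vector_space :: "'v::real_vector set \<Rightarrow> 'v set \<Rightarrow> bool"
  where "ordered_vector_space V C \<longleftrightarrow>
    subspace V \<and> C \<subseteq> V \<and> convex_cone C \<and> C \<inter> uminus ` C = {0}"

definition cone_le :: "'v::real_vector set \<Rightarrow> 'v \<Rightarrow> 'v \<Rightarrow> bool"
  where "cone_le C x y \<longleftrightarrow> y - x \<in> C"

definition is_infimum :: "'v::real_vector set \<Rightarrow> 'v set \<Rightarrow> 'v set \<Rightarrow> 'v \<Rightarrow> bool"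
  where "is_infimum V C S m \<longleftrightarrow>
    m \<in> V \<and> (\<forall>s\<in>S. cone_le C m s) \<and> (\<forall>l\<in>V. (\<forall>s\<in>S. cone_le C l s) \<longrightarrow> cone_le C l m)"

definition is_supremum :: "'v::real_vector set \<Rightarrow> 'v set \<Rightarrow> 'v set \<Rightarrow> 'v \<Rightarrow> bool"
  where "is_supremum V C S m \<longleftrightarrow>
    m \<in> V \<and> (\<forall>s\<in>S. cone_le C s m) \<and> (\<forall>u\<in>V. (\<forall>s\<in>S. cone_le C s u) \<longrightarrow> cone_le C m u)"

definition vector_lattice :: "'v::real_vector set \<Rightarrow> 'v set \<Rightarrow> bool"
  where "vector_lattice V C \<longleftrightarrow> ordered_vector_space V C \<and>
    (\<forall>x\<in>V. \<forall>y\<in>V. (\<exists>m. is_infimum V C {x, y} m) \<and> (\<exists>m. is_supremum V C {x, y} m))"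

definition archimedean :: "'v::real_vector set \<Rightarrow> 'v set \<Rightarrow> bool"
  where "archimedean V C \<longleftrightarrow>
    (\<forall>x\<in>V. \<forall>y\<in>V. (\<forall>n::nat. cone_le C (real n *\<^sub>R x) y) \<longrightarrow> cone_le C x 0)"

definition order_dense :: "'v::real_vector set \<Rightarrow> 'v set \<Rightarrow> 'v set \<Rightarrow> bool"
  where "order_dense V C D \<longleftrightarrow>
    subspace D \<and> D \<subseteq> V \<and> (\<forall>y\<in>V. is_infimum V C {z\<in>D. cone_le C y z} y)"

text \<open>
  From here on the space \<open>X\<close> is an entire type \<open>'a\<close>, with positive cone \<open>K\<close>.
\<close>

definition vector_lattice_cover ::
    "'a::real_vector set \<Rightarrow> 'v::real_vector set \<Rightarrow> 'v set \<Rightarrow> ('a \<Rightarrow> 'v) \<Rightarrow> bool"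
  where "vector_lattice_cover K Y C i \<longleftrightarrow> vector_lattice Y C \<and>
    linear i \<and> range i \<subseteq> Y \<and> (\<forall>x. i x \<in> C \<longleftrightarrow> x \<in> K) \<and> order_dense Y C (range i)"

definition pervasive_cover ::
    "'a::real_vector set \<Rightarrow> 'v::real_vector set \<Rightarrow> 'v set \<Rightarrow> ('a \<Rightarrow> 'v) \<Rightarrow> bool"
  where "pervasive_cover K Y C i \<longleftrightarrow> vector_lattice_cover K Y C i \<and>
    (\<forall>y\<in>C. y \<noteq> 0 \<longrightarrow> (\<exists>x. cone_le C 0 (i x) \<and> i x \<noteq> 0 \<and> cone_le C (i x) y))"

text \<open>
  HOL cannot quantify existentially over the type in which a cover lives, so the two definitions
  below let covers range over the subspaces of one type, the free real vector space
  \<^typ>\<open>'a set \<Rightarrow>\<^sub>0 real\<close> on the power set of \<open>X\<close>. This loses nothing: by order density an element \<open>y\<close>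
  of a cover is determined by \<open>{x. y \<le> i x}\<close>, so a Hamel basis of the cover embeds into the power
  set of \<open>X\<close>. The lemmas \<open>pre_rieszI\<close> and \<open>pervasive_spaceI\<close> below prove this for covers in arbitrary types.
\<close>

definition pre_riesz :: "'a::real_vector set \<Rightarrow> bool"
  where "pre_riesz K \<longleftrightarrow> ordered_vector_space UNIV K \<and>
    (\<exists>(Y :: ('a set \<Rightarrow>\<^sub>0 real) set) C i. vector_lattice_cover K Y C i)"

definition pervasive_space :: "'a::real_vector set \<Rightarrow> bool"
  where "pervasive_space K \<longleftrightarrow> ordered_vector_space UNIV K \<and>
    (\<exists>(Y :: ('a set \<Rightarrow>\<^sub>0 real) set) C i. pervasive_cover K Y C i)"


lemma lookup_scaleR_real:
  "Poly_Mapping.lookup (r *\<^sub>R (p :: 'k \<Rightarrow>\<^sub>0 real)) k = r * Poly_Mapping.lookup p k"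
proof -
  have "finite {k. r *\<^sub>R Poly_Mapping.lookup p k \<noteq> 0}"
    by (rule finite_subset[OF _ finite_lookup[of p]]) auto
  then show ?thesis
    by (simp add: scaleR_poly_mapping_def Abs_poly_mapping_inverse)
qed

lemma cover_upper_sets_inj:
  assumes "vector_lattice_cover K Y C i"
  shows "inj_on (\<lambda>y. {x. cone_le C y (i x)}) Y"
proof (rule inj_onI)
  fix y z assume yz: "y \<in> Y" "z \<in> Y" and eq: "{x. cone_le C y (i x)} = {x. cone_le C z (i x)}"
  have "is_infimum Y C {w \<in> range i. cone_le C y w} y" "is_infimum Y C {w \<in> range i. cone_le C z w} z"
    using assms yz by (auto simp: vector_lattice_cover_def order_dense_def)
  moreover have "{w \<in> range i. cone_le C y w} = {w \<in> range i. cone_le C z w}"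
    using eq by auto
  ultimately have "cone_le C y z" "cone_le C z y"
    using yz by (auto simp: is_infimum_def)
  then have "z - y \<in> C \<inter> uminus ` C"
    unfolding cone_le_def by (auto intro: image_eqI[where x = "y - z"])
  moreover have "C \<inter> uminus ` C = {0}"
    using assms by (simp add: vector_lattice_cover_def vector_lattice_def ordered_vector_space_def)
  ultimately show "y = z"
    by simp
qed

lemma cover_embedding:
  fixes K :: "'a::real_vector set" and Y :: "'v::real_vector set"
  assumes "vector_lattice_cover K Y C i"
  shows "\<exists>j :: 'v \<Rightarrow> ('a set \<Rightarrow>\<^sub>0 real). linear j \<and> inj_on j Y"
proof -
  define U where "U y = {x. cone_le C y (i x)}" for y
  have U: "inj_on U Y"
    unfolding U_def by (rule cover_upper_sets_inj[OF assms])
  have sY: "subspace Y"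
    using assms by (simp add: vector_lattice_cover_def vector_lattice_def ordered_vector_space_def)
  obtain B where B: "B \<subseteq> Y" "independent B" "Y \<subseteq> span B"
    using maximal_independent_subset by blast
  obtain j :: "'v \<Rightarrow> ('a set \<Rightarrow>\<^sub>0 real)"
    where j: "linear j" "\<And>b. b \<in> B \<Longrightarrow> j b = Poly_Mapping.single (U b) 1"
    using linear_independent_extend[OF B(2), of "\<lambda>b. Poly_Mapping.single (U b) (1::real)"] by blast
  have "x = 0" if x: "x \<in> Y" and jx: "j x = 0" for x
  proof -
    let ?R = "{b. representation B x b \<noteq> 0}"
    have RB: "?R \<subseteq> B"
      by (auto intro: representation_ne_zero)
    have sum: "(\<Sum>b\<in>?R. representation B x b *\<^sub>R b) = x"
      using B x by (intro sum_nonzero_representation_eq) auto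
    have "j x = (\<Sum>b\<in>?R. representation B x b *\<^sub>R j b)"
      using linear_sum[OF j(1), of "\<lambda>b. representation B x b *\<^sub>R b" ?R]
      by (simp add: sum linear_scale[OF j(1)])
    then have 0: "(\<Sum>b\<in>?R. representation B x b *\<^sub>R j b) = 0"
      using jx by simp
    have "representation B x c = 0" if c: "c \<in> ?R" for c
    proof -
      have cB: "c \<in> B"
        using c RB by blast
      have "0 = Poly_Mapping.lookup (\<Sum>b\<in>?R. representation B x b *\<^sub>R j b) (U c)"
        by (simp only: 0 lookup_zero)
      also have "\<dots> = (\<Sum>b\<in>?R. representation B x b * Poly_Mapping.lookup (j b) (U c))"
        by (simp add: lookup_sum lookup_scaleR_real)
      also have "\<dots> = (\<Sum>b\<in>?R. if b = c then representation B x b else 0)"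
      proof (rule sum.cong[OF refl])
        fix b assume "b \<in> ?R"
        then have "b \<in> B"
          using RB by blast
        then have "U b = U c \<longleftrightarrow> b = c"
          using U cB B(1) by (auto dest: inj_onD)
        with \<open>b \<in> B\<close>
        show "representation B x b * Poly_Mapping.lookup (j b) (U c) =
            (if b = c then representation B x b else 0)"
          by (simp add: j(2) lookup_single)
      qed
      also have "\<dots> = representation B x c"
        using c by (simp add: finite_representation)
      finally show ?thesis by simp
    qed
    then have "?R = {}" by blast
    with sum show "x = 0" by simp
  qed
  then have "inj_on j Y"
    by (simp add: linear_injective_on_subspace_0[OF j(1) sY])
  with j(1) show ?thesis by blast
qed

lemma cover_transport:
  fixes K :: "'a::real_vector set" and Y :: "'v::real_vector set" and j :: "'v \<Rightarrow> 'w::real_vector"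
  assumes cov: "vector_lattice_cover K Y C i" and j: "linear j" "inj_on j Y"
  shows "vector_lattice_cover K (j ` Y) (j ` C) (j \<circ> i)"
    and "pervasive_cover K Y C i \<Longrightarrow> pervasive_cover K (j ` Y) (j ` C) (j \<circ> i)"
proof -
  have Y: "subspace Y" and CY: "C \<subseteq> Y" and cC: "convex_cone C" and pC: "C \<inter> uminus ` C = {0}"
    and lat: "\<And>x y. x \<in> Y \<Longrightarrow> y \<in> Y \<Longrightarrow>
      (\<exists>m. is_infimum Y C {x, y} m) \<and> (\<exists>m. is_supremum Y C {x, y} m)"
    and i: "linear i" "range i \<subseteq> Y" "\<And>x. i x \<in> C \<longleftrightarrow> x \<in> K"
    and dense: "\<And>y. y \<in> Y \<Longrightarrow> is_infimum Y C {z \<in> range i. cone_le C y z} y"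
    using cov by (auto simp: vector_lattice_cover_def vector_lattice_def ordered_vector_space_def
        order_dense_def)
  have jC: "j x \<in> j ` C \<longleftrightarrow> x \<in> C" if "x \<in> Y" for x
    using that CY j(2) by (auto dest: inj_onD)
  have le: "cone_le (j ` C) (j x) (j y) \<longleftrightarrow> cone_le C x y" if "x \<in> Y" "y \<in> Y" for x y
    using jC[of "y - x"] subspace_diff[OF Y] that
    by (simp add: cone_le_def linear_diff[OF j(1)])
  have inf: "is_infimum (j ` Y) (j ` C) (j ` S) (j m)" if "is_infimum Y C S m" "S \<subseteq> Y" for S m
    using that by (auto simp: is_infimum_def le subset_iff)
  have sup: "is_supremum (j ` Y) (j ` C) (j ` S) (j m)" if "is_supremum Y C S m" "S \<subseteq> Y" for S m
    using that by (auto simp: is_supremum_def le subset_iff)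
  have "j ` C \<inter> uminus ` j ` C = {0}"
  proof -
    have "uminus ` j ` C = j ` uminus ` C"
      by (auto simp: image_image linear_neg[OF j(1)])
    moreover have "uminus ` C \<subseteq> Y"
      using CY subspace_neg[OF Y] by auto
    ultimately have "j ` C \<inter> uminus ` j ` C = j ` (C \<inter> uminus ` C)"
      using inj_on_image_Int[OF j(2) CY] by simp
    then show ?thesis
      by (simp add: pC linear_0[OF j(1)])
  qed
  then have ovs: "ordered_vector_space (j ` Y) (j ` C)"
    using CY convex_cone_linear_image[of C j] cC j(1) linear_subspace_image[OF j(1) Y]
    by (auto simp: ordered_vector_space_def)
  have lat': "vector_lattice (j ` Y) (j ` C)"
    unfolding vector_lattice_def
  proof (intro conjI ovs ballI)
    fix x' y' assume "x' \<in> j ` Y" "y' \<in> j ` Y"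
    then obtain x y where xy: "x \<in> Y" "y \<in> Y" "x' = j x" "y' = j y" by blast
    from lat[OF xy(1,2)] obtain m M where "is_infimum Y C {x, y} m" "is_supremum Y C {x, y} M"
      by blast
    from inf[OF this(1)] sup[OF this(2)] xy
    show "\<exists>m. is_infimum (j ` Y) (j ` C) {x', y'} m" "\<exists>m. is_supremum (j ` Y) (j ` C) {x', y'} m"
      by auto
  qed
  have dense': "order_dense (j ` Y) (j ` C) (range (j \<circ> i))"
    unfolding order_dense_def
  proof (intro conjI ballI)
    show "subspace (range (j \<circ> i))"
      using linear_compose[OF i(1) j(1)] by (intro linear_subspace_image) (auto simp: subspace_UNIV)
    show "range (j \<circ> i) \<subseteq> j ` Y"
      using i(2) by auto
    fix y' assume "y' \<in> j ` Y"
    then obtain y where y: "y \<in> Y" "y' = j y" by blast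
    have "{z \<in> range (j \<circ> i). cone_le (j ` C) y' z} = j ` {z \<in> range i. cone_le C y z}"
      using i(2) y by (auto simp: le image_subset_iff)
    then show "is_infimum (j ` Y) (j ` C) {z \<in> range (j \<circ> i). cone_le (j ` C) y' z} y'"
      using inf[OF dense[OF y(1)]] i(2) y(2) by auto
  qed
  show cov': "vector_lattice_cover K (j ` Y) (j ` C) (j \<circ> i)"
    unfolding vector_lattice_cover_def
    using lat' dense' linear_compose[OF i(1) j(1)] i(2,3) jC by (auto simp: image_subset_iff)
  assume perv: "pervasive_cover K Y C i"
  show "pervasive_cover K (j ` Y) (j ` C) (j \<circ> i)"
    unfolding pervasive_cover_def
  proof (intro conjI cov' ballI impI)
    fix y' assume "y' \<in> j ` C" "y' \<noteq> 0"
    then obtain y where y: "y \<in> C" "y' = j y" "y \<noteq> 0"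
      using linear_0[OF j(1)] by auto
    then obtain x where x: "cone_le C 0 (i x)" "i x \<noteq> 0" "cone_le C (i x) y"
      using perv by (auto simp: pervasive_cover_def)
    have 0: "0 \<in> Y" "j 0 = 0" and ix: "i x \<in> Y" and yY: "y \<in> Y"
      using Y subspace_0 linear_0[OF j(1)] i(2) y CY by auto
    have "j (i x) \<noteq> 0"
      using inj_onD[OF j(2), of "i x" 0] x(2) 0 ix by auto
    then show "\<exists>x. cone_le (j ` C) 0 ((j \<circ> i) x) \<and> (j \<circ> i) x \<noteq> 0 \<and> cone_le (j ` C) ((j \<circ> i) x) y'"
      using le[OF 0(1) ix] le[OF ix yY] x y(2) 0(2) by (intro exI[of _ x]) simp
  qed
qed

lemma pre_rieszI:
  fixes K :: "'a::real_vector set" and Y :: "'v::real_vector set"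
  assumes "ordered_vector_space UNIV K" "vector_lattice_cover K Y C i"
  shows "pre_riesz K"
  using cover_embedding[OF assms(2)] cover_transport(1)[OF assms(2)] assms(1)
  unfolding pre_riesz_def by blast

lemma pervasive_spaceI:
  fixes K :: "'a::real_vector set" and Y :: "'v::real_vector set"
  assumes "ordered_vector_space UNIV K" "pervasive_cover K Y C i"
  shows "pervasive_space K"
proof -
  have cov: "vector_lattice_cover K Y C i"
    using assms(2) by (simp add: pervasive_cover_def)
  show ?thesis
    using cover_embedding[OF cov] cover_transport(2)[OF cov] assms
    unfolding pervasive_space_def by blast
qed

end

theory Submission
  imports Defs
begin

text \<open>
  A vector lattice is a cover of itself, and pervasiveness of this cover is trivial.

  Conversely, let \<open>(Y, i)\<close> be a pervasive cover of the \<open>n\<close>-dimensional space \<open>X\<close>; the point is that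
  \<open>i\<close> is onto, so that \<open>X\<close> is isomorphic to the lattice \<open>Y\<close>. Pairwise disjoint nonzero positive
  elements are linearly independent (\<open>independent_if_disjoint\<close>), so a finite set of such elements in
  \<open>i(X)\<close> has at most \<open>n\<close> members. Choose one, \<open>D\<close>, with as many members as possible. As every nonzero
  positive element of \<open>Y\<close> dominates a nonzero positive element of \<open>i(X)\<close>, maximality gives two facts:
  only \<open>0\<close> is disjoint from all of \<open>D\<close>, and no \<open>e \<in> D\<close> dominates two disjoint nonzero positive
  elements. Pervasiveness also carries the Archimedean property from \<open>X\<close> over to \<open>Y\<close>
  (\<open>archimedean_cover\<close>), and in an Archimedean lattice the second fact means that every \<open>w\<close> with
  \<open>0 < w \<le> e\<close> lies above some \<open>t e\<close> with \<open>t > 0\<close> (\<open>atom_below\<close>).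

  Now let \<open>y \<ge> 0\<close> in \<open>Y\<close>, and for \<open>e \<in> D\<close> let \<open>c e\<close> be the largest real \<open>t\<close> with \<open>t e \<le> y\<close>. By
  disjointness \<open>\<Sum>e\<in>D. c e e \<le> y\<close>. If the difference \<open>z\<close> were nonzero, some \<open>w > 0\<close> would lie below
  both \<open>z\<close> and some \<open>e \<in> D\<close>, hence \<open>t e \<le> w \<le> z\<close> with \<open>t > 0\<close>, and \<open>(c e + t) e \<le> y\<close> would
  contradict the choice of \<open>c e\<close>. So \<open>y\<close> is in the span of \<open>D\<close>, which is contained in \<open>i(X)\<close>; since
  \<open>Y\<close> is spanned by its positive elements, \<open>i\<close> is onto.
\<close>

section \<open>Disjoint elements of a vector lattice\<close>

text \<open>
  Disjointness of positive elements, that is \<open>u \<and> v = 0\<close>, expressed without the infimum: \<open>0\<close> is the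
  only positive common lower bound. It is used for elements of \<open>C\<close> only.
\<close>

definition cone_disjoint :: "'v::real_vector set \<Rightarrow> 'v \<Rightarrow> 'v \<Rightarrow> bool"
  where "cone_disjoint C u v \<longleftrightarrow> (\<forall>w\<in>C. u - w \<in> C \<longrightarrow> v - w \<in> C \<longrightarrow> w = 0)"

lemma cone_disjointD:
  "cone_disjoint C u v \<Longrightarrow> w \<in> C \<Longrightarrow> u - w \<in> C \<Longrightarrow> v - w \<in> C \<Longrightarrow> w = 0"
  by (simp add: cone_disjoint_def)

lemma cone_disjoint_sym: "cone_disjoint C u v \<Longrightarrow> cone_disjoint C v u"
  by (simp add: cone_disjoint_def)

locale cone_lattice =
  fixes Y C :: "'v::real_vector set"
  assumes lattice: "vector_lattice Y C"
begin

lemma Y: "subspace Y"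
  and C_Y: "x \<in> C \<Longrightarrow> x \<in> Y"
  and C_cone: "convex_cone C"
  and C_pointed: "C \<inter> uminus ` C = {0}"
  using lattice by (auto simp: vector_lattice_def ordered_vector_space_def)

lemma C_add: "x \<in> C \<Longrightarrow> y \<in> C \<Longrightarrow> x + y \<in> C"
  using C_cone by (simp add: convex_cone_iff)

lemma C_scale: "x \<in> C \<Longrightarrow> 0 \<le> r \<Longrightarrow> r *\<^sub>R x \<in> C"
  using C_cone by (simp add: convex_cone_iff)

lemma C_0: "0 \<in> C"
  using C_pointed by auto

lemma C_antisym: "x \<in> C \<Longrightarrow> - x \<in> C \<Longrightarrow> x = 0"
  using C_pointed by force

lemma C_trans: "y - x \<in> C \<Longrightarrow> z - y \<in> C \<Longrightarrow> z - x \<in> C"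
  using C_add[of "y - x" "z - y"] by simp

lemma C_sum: "(\<And>a. a \<in> A \<Longrightarrow> f a \<in> C) \<Longrightarrow> sum f A \<in> C"
  by (induction A rule: infinite_finite_induct) (auto intro: C_0 C_add)

lemma infimum_exists:
  assumes "x \<in> Y" "y \<in> Y"
  obtains m where "m \<in> Y" "x - m \<in> C" "y - m \<in> C"
    "\<And>l. l \<in> Y \<Longrightarrow> x - l \<in> C \<Longrightarrow> y - l \<in> C \<Longrightarrow> m - l \<in> C"
  using lattice assms by (fastforce simp: vector_lattice_def is_infimum_def cone_le_def)

lemma supremum_exists:
  assumes "x \<in> Y" "y \<in> Y"
  obtains m where "m \<in> Y" "m - x \<in> C" "m - y \<in> C"
    "\<And>u. u \<in> Y \<Longrightarrow> u - x \<in> C \<Longrightarrow> u - y \<in> C \<Longrightarrow> u - m \<in> C"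
  using lattice assms by (fastforce simp: vector_lattice_def is_supremum_def cone_le_def)

lemma cone_disjoint_mono:
  assumes "cone_disjoint C u v" "u - u' \<in> C" "v - v' \<in> C"
  shows "cone_disjoint C u' v'"
  unfolding cone_disjoint_def
proof (intro ballI impI)
  fix w assume "w \<in> C" "u' - w \<in> C" "v' - w \<in> C"
  then show "w = 0"
    using cone_disjointD[OF assms(1)] C_trans[OF _ assms(2)] C_trans[OF _ assms(3)] by blast
qed

lemma cone_disjoint_self: "cone_disjoint C u u \<Longrightarrow> u \<in> C \<Longrightarrow> u = 0"
  using cone_disjointD[of C u u u] C_0 by simp

lemma cone_disjoint_0: "cone_disjoint C 0 v"
  by (auto simp: cone_disjoint_def intro: C_antisym)

lemma cone_disjoint_add:
  assumes "u \<in> C" "v \<in> C" "cone_disjoint C u w" "cone_disjoint C v w"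
  shows "cone_disjoint C (u + v) w"
  unfolding cone_disjoint_def
proof (intro ballI impI)
  fix x assume x: "x \<in> C" "u + v - x \<in> C" "w - x \<in> C"
  obtain m where m: "m \<in> Y" "x - m \<in> C" "u - m \<in> C"
    and max: "\<And>l. l \<in> Y \<Longrightarrow> x - l \<in> C \<Longrightarrow> u - l \<in> C \<Longrightarrow> m - l \<in> C"
    using infimum_exists[of x u] x(1) assms(1) C_Y by blast
  have "m \<in> C"
    using max[of 0] x(1) assms(1) subspace_0[OF Y] by simp
  then have "m = 0"
    using cone_disjointD[OF assms(3), of m] m C_trans[OF m(2) x(3)] by blast
  \<comment> \<open>\<open>x - v\<close> is a lower bound of \<open>x\<close> and \<open>u\<close>, whose infimum is \<open>0\<close>.\<close>
  then have "v - x \<in> C"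
    using max[of "x - v"] x assms(2) subspace_diff[OF Y] C_Y by (simp add: algebra_simps)
  then show "x = 0"
    using cone_disjointD[OF assms(4)] x by blast
qed

lemma cone_disjoint_scale:
  assumes "u \<in> C" "0 \<le> r" "cone_disjoint C u w"
  shows "cone_disjoint C (r *\<^sub>R u) w"
  unfolding cone_disjoint_def
proof (intro ballI impI)
  fix x assume x: "x \<in> C" "r *\<^sub>R u - x \<in> C" "w - x \<in> C"
  define s where "s = max 1 r"
  have s: "s \<ge> 1" "s \<ge> r" "s > 0"
    by (auto simp: s_def)
  have "(s - r) *\<^sub>R u + (r *\<^sub>R u - x) \<in> C"
    using s x assms by (intro C_add C_scale) auto
  then have "(1 / s) *\<^sub>R (s *\<^sub>R u - x) \<in> C"
    using s by (intro C_scale) (auto simp: algebra_simps)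
  then have 1: "u - (1 / s) *\<^sub>R x \<in> C"
    using s by (simp add: algebra_simps)
  have "(1 - 1 / s) *\<^sub>R x \<in> C"
    using s x by (intro C_scale) auto
  then have 2: "w - (1 / s) *\<^sub>R x \<in> C"
    using x(3) C_trans[of x "(1 / s) *\<^sub>R x" w] by (simp add: algebra_simps)
  have "(1 / s) *\<^sub>R x = 0"
    using cone_disjointD[OF assms(3) _ 1 2] x(1) s C_scale by simp
  then show "x = 0"
    using s by simp
qed

lemma cone_disjoint_sum:
  assumes "finite A" "\<And>a. a \<in> A \<Longrightarrow> f a \<in> C" "\<And>a. a \<in> A \<Longrightarrow> cone_disjoint C (f a) w"
  shows "cone_disjoint C (sum f A) w"
  using assms
  by (induction A rule: finite_induct) (auto intro!: cone_disjoint_0 cone_disjoint_add C_sum)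

text \<open>For disjoint \<open>u\<close> and \<open>v\<close> the sum is the supremum.\<close>

lemma disjoint_add_le:
  assumes "u \<in> C" "v \<in> C" "cone_disjoint C u v" "y \<in> Y" "y - u \<in> C" "y - v \<in> C"
  shows "y - (u + v) \<in> C"
proof -
  obtain s where s: "s \<in> Y" "s - u \<in> C" "s - v \<in> C"
    and min: "\<And>b. b \<in> Y \<Longrightarrow> b - u \<in> C \<Longrightarrow> b - v \<in> C \<Longrightarrow> b - s \<in> C"
    using supremum_exists[of u v] assms C_Y by blast
  have "u + v - s \<in> C"
    using min[of "u + v"] assms C_Y C_add by simp
  then have "u + v - s = 0"
    using s by (intro cone_disjointD[OF assms(3)]) (auto simp: algebra_simps)
  then show ?thesis
    using min[OF assms(4-6)] by simp
qed

lemma disjoint_sum_le: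
  assumes "finite A" "\<And>a. a \<in> A \<Longrightarrow> f a \<in> C" "pairwise (\<lambda>a b. cone_disjoint C (f a) (f b)) A"
    and "y \<in> C" "\<And>a. a \<in> A \<Longrightarrow> y - f a \<in> C"
  shows "y - sum f A \<in> C"
  using assms
proof (induction A rule: finite_induct)
  case empty
  then show ?case by simp
next
  case (insert a A)
  have "cone_disjoint C (sum f A) (f a)"
    using insert by (intro cone_disjoint_sum) (auto simp: pairwise_insert)
  moreover have "y - sum f A \<in> C"
    using insert by (auto simp: pairwise_insert)
  ultimately have "y - (sum f A + f a) \<in> C"
    using insert by (intro disjoint_add_le C_sum C_Y) auto
  then show ?case
    using insert by (simp add: add.commute)
qed

text \<open>
  Subtracting the infimum leaves disjoint remainders.
\<close>

lemma disjoint_remainders: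
  assumes "x \<in> C" "y \<in> C"
  obtains m where "m \<in> C" "x - m \<in> C" "y - m \<in> C" "cone_disjoint C (x - m) (y - m)"
proof -
  obtain m where m: "m \<in> Y" "x - m \<in> C" "y - m \<in> C"
    and max: "\<And>l. l \<in> Y \<Longrightarrow> x - l \<in> C \<Longrightarrow> y - l \<in> C \<Longrightarrow> m - l \<in> C"
    using infimum_exists[of x y] assms C_Y by blast
  have "m \<in> C"
    using max[of 0] assms subspace_0[OF Y] by simp
  moreover have "cone_disjoint C (x - m) (y - m)"
    unfolding cone_disjoint_def
  proof (intro ballI impI)
    fix w assume w: "w \<in> C" "x - m - w \<in> C" "y - m - w \<in> C"
    then have "m - (m + w) \<in> C"
      using m(1) C_Y subspace_add[OF Y] by (intro max) (auto simp: algebra_simps)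
    then show "w = 0"
      using w(1) by (intro C_antisym) auto
  qed
  ultimately show ?thesis
    using that m by blast
qed

lemma independent_if_disjoint:
  assumes "finite D" "D \<subseteq> C - {0}" "pairwise (cone_disjoint C) D"
  shows "independent D"
proof
  assume "dependent D"
  then obtain e where e: "e \<in> D" "e \<in> span (D - {e})"
    by (auto simp: dependent_def)
  then obtain c where c: "e = (\<Sum>d\<in>D - {e}. c d *\<^sub>R d)"
    using assms(1) by (auto simp: span_finite)
  \<comment> \<open>\<open>s\<close> is disjoint from \<open>e\<close> and yet dominates it.\<close>
  define s where "s = (\<Sum>d\<in>D - {e}. \<bar>c d\<bar> *\<^sub>R d)"
  have "cone_disjoint C s e"
    unfolding s_def using assms e(1)
    by (intro cone_disjoint_sum cone_disjoint_scale C_scale) (auto simp: pairwise_def)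
  moreover have "s - e = (\<Sum>d\<in>D - {e}. (\<bar>c d\<bar> - c d) *\<^sub>R d)"
    by (subst c) (simp add: s_def sum_subtractf algebra_simps)
  then have "s - e \<in> C"
    using assms(2) by (auto intro!: C_sum C_scale)
  ultimately have "e = 0"
    using e(1) assms(2) C_0 by (intro cone_disjointD[of C s e]) auto
  then show False
    using e(1) assms(2) by auto
qed

lemma Y_generated:
  assumes "y \<in> Y"
  obtains p q where "p \<in> C" "q \<in> C" "y = p - q"
proof -
  obtain p where "p - y \<in> C" "p - 0 \<in> C"
    using supremum_exists[OF assms subspace_0[OF Y]] by blast
  then show ?thesis
    using that[of p "p - y"] by simp
qed

end

section \<open>Pervasive covers of Archimedean spaces\<close>

locale pervasive_archimedean_cover =
  fixes K :: "'a::real_vector set" and Y C :: "'v::real_vector set" and i :: "'a \<Rightarrow> 'v"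
  assumes ordered: "ordered_vector_space UNIV K"
    and arch: "archimedean UNIV K"
    and cover: "pervasive_cover K Y C i"
begin

lemma i_linear: "linear i"
  and range_i: "i x \<in> Y"
  and bipositive: "i x \<in> C \<longleftrightarrow> x \<in> K"
  and dense: "order_dense Y C (range i)"
  using cover by (auto simp: pervasive_cover_def vector_lattice_cover_def)

sublocale cone_lattice Y C
  using cover by unfold_locales (simp add: pervasive_cover_def vector_lattice_cover_def)

lemma subspace_range: "subspace (range i)"
  using linear_subspace_image[OF i_linear subspace_UNIV] .

lemma pervasiveE:
  assumes "y \<in> C" "y \<noteq> 0"
  obtains x where "x \<in> range i" "x \<in> C" "x \<noteq> 0" "y - x \<in> C"
proof -
  obtain x where "i x \<in> C" "i x \<noteq> 0" "y - i x \<in> C"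
    using cover assms by (auto simp: pervasive_cover_def cone_le_def)
  then show ?thesis
    using that[of "i x"] by simp
qed

lemma majorized:
  assumes "y \<in> Y"
  obtains b where "i b - y \<in> C"
proof (cases "\<exists>b. i b - y \<in> C")
  case True
  then show ?thesis using that by blast
next
  case False
  \<comment> \<open>Otherwise \<open>y\<close> is the infimum of the empty set, that is, the greatest element of \<open>Y\<close>.\<close>
  have empty: "{z \<in> range i. cone_le C y z} = {}"
    using False by (auto simp: cone_le_def)
  have "is_infimum Y C {z \<in> range i. cone_le C y z} y"
    using dense assms by (simp add: order_dense_def)
  then have "is_infimum Y C {} y"
    by (simp only: empty)
  then have "y - l \<in> C" if "l \<in> Y" for l
    using that by (simp add: is_infimum_def cone_le_def)
  from this[of "y + y"] this[of 0] have "- y \<in> C" "y \<in> C"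
    using assms subspace_0[OF Y] subspace_add[OF Y] by simp_all
  then have "y = 0"
    using C_antisym by blast
  with False have "i 0 - y \<notin> C"
    by blast
  then show ?thesis
    using \<open>y = 0\<close> C_0 linear_0[OF i_linear] by simp
qed

lemma archimedean_cover:
  assumes "u \<in> Y" "z \<in> C" "\<And>n::nat. z - real n *\<^sub>R u \<in> C"
  shows "- u \<in> C"
proof -
  \<comment> \<open>The positive part \<open>p\<close> of \<open>u\<close> satisfies the same inequalities.\<close>
  obtain p where p: "p \<in> Y" "p - u \<in> C" "p - 0 \<in> C"
    and min: "\<And>b. b \<in> Y \<Longrightarrow> b - u \<in> C \<Longrightarrow> b - 0 \<in> C \<Longrightarrow> b - p \<in> C"
    using supremum_exists[OF assms(1) subspace_0[OF Y]] by blast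
  have np: "z - real n *\<^sub>R p \<in> C" for n
  proof (cases "n = 0")
    case True
    then show ?thesis using assms(2) by simp
  next
    case False
    have "(1 / real n) *\<^sub>R (z - real n *\<^sub>R u) \<in> C"
      using assms(3) by (intro C_scale) auto
    then have "(1 / real n) *\<^sub>R z - u \<in> C"
      using False by (simp add: algebra_simps)
    then have "(1 / real n) *\<^sub>R z - p \<in> C"
      using assms(2) C_scale[of z "1 / real n"] by (intro min) (auto intro: C_Y)
    then have "real n *\<^sub>R ((1 / real n) *\<^sub>R z - p) \<in> C"
      by (intro C_scale) auto
    then show ?thesis
      using False by (simp add: algebra_simps)
  qed
  have "p = 0"
  proof (rule ccontr)
    assume "p \<noteq> 0"
    then obtain x where x: "i x \<in> C" "i x \<noteq> 0" "p - i x \<in> C"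
      using pervasiveE[of p] p(3) by auto
    obtain b where b: "i b - z \<in> C"
      using majorized C_Y assms(2) by blast
    have "b - real n *\<^sub>R x \<in> K" for n
    proof -
      have "(z - real n *\<^sub>R p) + real n *\<^sub>R (p - i x) \<in> C"
        using np x(3) by (intro C_add C_scale) auto
      then have "z - real n *\<^sub>R i x \<in> C"
        by (simp add: algebra_simps)
      then have "i (b - real n *\<^sub>R x) \<in> C"
        using b C_trans by (simp add: linear_diff[OF i_linear] linear_scale[OF i_linear])
      then show ?thesis
        by (simp add: bipositive)
    qed
    then have "- x \<in> K"
      using arch by (auto simp: archimedean_def cone_le_def)
    then have "- i x \<in> C"
      using bipositive[of "- x"] by (simp add: linear_neg[OF i_linear])
    then show False
      using x C_antisym by blast
  qed
  then show ?thesis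
    using p(2) by simp
qed

text \<open>
  The coefficients \<open>t\<close> with \<open>t e \<le> y\<close> are bounded above and their supremum is attained, both by
  the Archimedean property.
\<close>

lemma greatest_coefficient:
  assumes "y \<in> C" "e \<in> C" "e \<noteq> 0"
  obtains c where "c \<ge> 0" "y - c *\<^sub>R e \<in> C" "\<And>t. y - t *\<^sub>R e \<in> C \<Longrightarrow> t \<le> c"
proof -
  define T where "T = {t. y - t *\<^sub>R e \<in> C}"
  have down: "y - s *\<^sub>R e \<in> C" if "t \<in> T" "s \<le> t" for s t
  proof -
    have "(y - t *\<^sub>R e) + (t - s) *\<^sub>R e \<in> C"
      using that assms by (intro C_add C_scale) (auto simp: T_def)
    then show ?thesis
      by (simp add: algebra_simps)
  qed
  have 0: "0 \<in> T"
    using assms by (simp add: T_def)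
  have bdd: "bdd_above T"
  proof (rule ccontr)
    assume "\<not> bdd_above T"
    then have "\<exists>t\<in>T. real n \<le> t" for n
      unfolding bdd_above_def by (meson linear)
    then have "y - real n *\<^sub>R e \<in> C" for n
      using down by blast
    then have "- e \<in> C"
      using archimedean_cover assms C_Y by blast
    then show False
      using assms C_antisym by blast
  qed
  define c where "c = Sup T"
  have "e - real n *\<^sub>R (c *\<^sub>R e - y) \<in> C" for n
  proof (cases "n = 0")
    case True
    then show ?thesis using assms by simp
  next
    case False
    then have "c - 1 / real n < Sup T"
      by (simp add: c_def)
    then obtain t where "t \<in> T" "c - 1 / real n < t"
      using 0 less_cSupE[of "c - 1 / real n" T] by blast
    then have "y - (c - 1 / real n) *\<^sub>R e \<in> C"
      using down by simp
    then have "real n *\<^sub>R (y - (c - 1 / real n) *\<^sub>R e) \<in> C"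
      by (intro C_scale) auto
    then show ?thesis
      using False by (simp add: algebra_simps)
  qed
  then have "- (c *\<^sub>R e - y) \<in> C"
    using assms subspace_diff[OF Y] subspace_scale[OF Y] C_Y
    by (intro archimedean_cover[of _ e]) auto
  moreover have "t \<le> c" if "t \<in> T" for t
    using that bdd by (auto simp: c_def intro: cSup_upper)
  ultimately show ?thesis
    using that[of c] 0 by (auto simp: T_def)
qed

text \<open>
  If no two disjoint nonzero positive elements lie below \<open>e\<close>, then every nonzero positive element
  below \<open>e\<close> dominates a positive multiple of \<open>e\<close>.
\<close>

lemma atom_below:
  assumes "e \<in> C"
    and atom: "\<And>u v. u \<in> C \<Longrightarrow> v \<in> C \<Longrightarrow> e - u \<in> C \<Longrightarrow> e - v \<in> C \<Longrightarrow> cone_disjoint C u v \<Longrightarrow>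
      u = 0 \<or> v = 0"
    and w: "w \<in> C" "w \<noteq> 0" "e - w \<in> C"
  obtains t where "t > 0" "w - t *\<^sub>R e \<in> C"
proof (rule ccontr)
  assume "\<not> thesis"
  then have none: "w - t *\<^sub>R e \<notin> C" if "t > 0" for t
    using that \<open>\<And>t. 0 < t \<Longrightarrow> w - t *\<^sub>R e \<in> C \<Longrightarrow> thesis\<close> by blast
  \<comment> \<open>For \<open>0 < s \<le> 1\<close> the disjoint remainders of \<open>w\<close> and \<open>s e\<close> lie below \<open>e\<close>, so one of them is \<open>0\<close>;
    as \<open>s e \<le> w\<close> is excluded, this gives \<open>w \<le> s e\<close>.\<close>
  have "e - real n *\<^sub>R w \<in> C" for n
  proof (cases "n = 0")
    case True
    then show ?thesis using assms(1) by simp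
  next
    case False
    define s where "s = 1 / real n"
    have s: "s > 0" "s \<le> 1"
      using False by (auto simp: s_def)
    have se: "s *\<^sub>R e \<in> C" "e - s *\<^sub>R e \<in> C"
      using C_scale[OF assms(1), of s] C_scale[OF assms(1), of "1 - s"] s
      by (auto simp: algebra_simps)
    obtain m where m: "m \<in> C" "w - m \<in> C" "s *\<^sub>R e - m \<in> C" "cone_disjoint C (w - m) (s *\<^sub>R e - m)"
      using disjoint_remainders[OF w(1) se(1)] by blast
    have "e - (w - m) \<in> C" "e - (s *\<^sub>R e - m) \<in> C"
      using C_add[OF w(3) m(1)] C_add[OF se(2) m(1)] by (auto simp: algebra_simps)
    then have "w - m = 0 \<or> s *\<^sub>R e - m = 0"
      using atom m by blast
    then have "s *\<^sub>R e - w \<in> C"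
      using none[OF s(1)] m by auto
    then have "real n *\<^sub>R (s *\<^sub>R e - w) \<in> C"
      by (intro C_scale) auto
    then show ?thesis
      using False by (simp add: algebra_simps s_def)
  qed
  then have "- w \<in> C"
    using archimedean_cover w assms C_Y by blast
  then show False
    using w C_antisym by blast
qed

section \<open>Surjectivity in finite dimension\<close>

text \<open>The finite sets of pairwise disjoint nonzero positive elements of the image of \<open>i\<close>.\<close>

definition disjoint_system :: "'v set \<Rightarrow> bool"
  where "disjoint_system D \<longleftrightarrow>
    finite D \<and> D \<subseteq> range i \<and> D \<subseteq> C - {0} \<and> pairwise (cone_disjoint C) D"

lemma disjoint_system_insert:
  assumes "disjoint_system D" "x \<in> range i" "x \<in> C" "x \<noteq> 0" "\<And>d. d \<in> D \<Longrightarrow> cone_disjoint C d x"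
  shows "disjoint_system (insert x D)" "x \<notin> D"
proof -
  show "disjoint_system (insert x D)"
    using assms by (auto simp: disjoint_system_def pairwise_insert intro: cone_disjoint_sym)
  show "x \<notin> D"
    using assms cone_disjoint_self by blast
qed

lemma disjoint_system_card:
  assumes "finite B" "span B = (UNIV :: 'a set)" "disjoint_system D"
  shows "card D \<le> card B"
proof -
  have "span (i ` B) = range i"
    using linear_span_image[OF i_linear, of B] assms(2) by simp
  then have "card D \<le> card (i ` B)"
    using independent_span_bound[of "i ` B" D] independent_if_disjoint[of D] assms
    by (auto simp: disjoint_system_def)
  then show ?thesis
    using card_image_le[OF assms(1), of i] by simp
qed

lemma C_subset_range:
  assumes B: "finite B" "span B = (UNIV :: 'a set)"
  shows "C \<subseteq> range i"
proof
  fix y assume y: "y \<in> C"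
  have "disjoint_system {}"
    by (simp add: disjoint_system_def)
  moreover have "\<forall>D. disjoint_system D \<longrightarrow> card D < Suc (card B)"
    using disjoint_system_card[OF B] by (simp add: less_Suc_eq_le)
  ultimately obtain D where D: "disjoint_system D"
    and max: "\<And>D'. disjoint_system D' \<Longrightarrow> card D' \<le> card D"
    using ex_has_greatest_nat[of disjoint_system "{}" card] by blast
  have fin: "finite D" and DC: "\<And>e. e \<in> D \<Longrightarrow> e \<in> C \<and> e \<noteq> 0" and Di: "D \<subseteq> range i"
    and pw: "pairwise (cone_disjoint C) D"
    using D by (auto simp: disjoint_system_def)
  have total: "z = 0" if z: "z \<in> C" "\<And>e. e \<in> D \<Longrightarrow> cone_disjoint C e z" for z
  proof (rule ccontr)
    assume "z \<noteq> 0"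
    then obtain x where x: "x \<in> range i" "x \<in> C" "x \<noteq> 0" "z - x \<in> C"
      using pervasiveE z(1) by blast
    have "cone_disjoint C e x" if "e \<in> D" for e
      using cone_disjoint_mono[OF z(2)[OF that] _ x(4)] C_0 by simp
    then show False
      using disjoint_system_insert[OF D x(1-3)] max[of "insert x D"] fin by simp
  qed
  have atom: "u = 0 \<or> v = 0"
    if "e \<in> D" "u \<in> C" "v \<in> C" "e - u \<in> C" "e - v \<in> C" "cone_disjoint C u v" for e u v
  proof (rule ccontr)
    assume "\<not> (u = 0 \<or> v = 0)"
    then have "u \<noteq> 0" "v \<noteq> 0"
      by auto
    obtain x where x: "x \<in> range i" "x \<in> C" "x \<noteq> 0" "u - x \<in> C"
      using pervasiveE[OF \<open>u \<in> C\<close> \<open>u \<noteq> 0\<close>] .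
    obtain x' where x': "x' \<in> range i" "x' \<in> C" "x' \<noteq> 0" "v - x' \<in> C"
      using pervasiveE[OF \<open>v \<in> C\<close> \<open>v \<noteq> 0\<close>] .
    \<comment> \<open>Replacing \<open>e\<close> by the two elements \<open>x\<close> and \<open>x'\<close> enlarges \<open>D\<close>.\<close>
    have below: "cone_disjoint C d a" if "d \<in> D - {e}" "e - a \<in> C" for d a
      using cone_disjoint_mono[of d e d a] pw that \<open>e \<in> D\<close> C_0 by (auto simp: pairwise_def)
    have ex: "e - x \<in> C" "e - x' \<in> C"
      using that x x' C_trans by blast+
    have D0: "disjoint_system (D - {e})"
      using D by (auto simp: disjoint_system_def pairwise_def)
    have D1: "disjoint_system (insert x (D - {e}))" "x \<notin> D - {e}"
      using disjoint_system_insert[OF D0 x(1-3)] below ex by blast+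
    have "cone_disjoint C x x'"
      using cone_disjoint_mono that x x' by blast
    then have "disjoint_system (insert x' (insert x (D - {e})))" "x' \<notin> insert x (D - {e})"
      using disjoint_system_insert[OF D1(1) x'(1-3)] below ex by blast+
    then show False
      using max[of "insert x' (insert x (D - {e}))"] D1(2) fin \<open>e \<in> D\<close> card_Suc_Diff1[of D e] by simp
  qed
  have "\<forall>e\<in>D. \<exists>c\<ge>0. y - c *\<^sub>R e \<in> C \<and> (\<forall>t. y - t *\<^sub>R e \<in> C \<longrightarrow> t \<le> c)"
    using greatest_coefficient[OF y] DC by metis
  then obtain c where c: "\<And>e. e \<in> D \<Longrightarrow> c e \<ge> 0" "\<And>e. e \<in> D \<Longrightarrow> y - c e *\<^sub>R e \<in> C"
    and c_max: "\<And>e t. e \<in> D \<Longrightarrow> y - t *\<^sub>R e \<in> C \<Longrightarrow> t \<le> c e"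
    by metis
  define z where "z = y - (\<Sum>e\<in>D. c e *\<^sub>R e)"
  have ceC: "c e *\<^sub>R e \<in> C" if "e \<in> D" for e
    using that DC c(1) C_scale by blast
  have "cone_disjoint C (c e *\<^sub>R e) (c f *\<^sub>R f)" if "e \<in> D" "f \<in> D" "e \<noteq> f" for e f
    using that DC c(1) pw
    by (intro cone_disjoint_scale cone_disjoint_sym[OF cone_disjoint_scale])
       (auto simp: pairwise_def)
  then have zC: "z \<in> C"
    unfolding z_def using fin ceC c(2) y by (intro disjoint_sum_le) (auto simp: pairwise_def)
  have "z = 0"
  proof (rule total[OF zC])
    fix e assume e: "e \<in> D"
    show "cone_disjoint C e z"
      unfolding cone_disjoint_def
    proof (intro ballI impI, rule ccontr)
      fix w assume w: "w \<in> C" "e - w \<in> C" "z - w \<in> C" "w \<noteq> 0"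
      obtain t where t: "t > 0" "w - t *\<^sub>R e \<in> C"
        using atom_below[of e w] atom[OF e] DC[OF e] w by blast
      have "(\<Sum>d\<in>D. c d *\<^sub>R d) = c e *\<^sub>R e + (\<Sum>d\<in>D - {e}. c d *\<^sub>R d)"
        using fin e by (simp add: sum.remove)
      then have "y - (c e + t) *\<^sub>R e = (\<Sum>d\<in>D - {e}. c d *\<^sub>R d) + ((z - w) + (w - t *\<^sub>R e))"
        by (simp add: z_def algebra_simps)
      also have "\<dots> \<in> C"
        using ceC w(3) t(2) by (intro C_add C_sum) auto
      finally show False
        using c_max[OF e] t(1) by fastforce
    qed
  qed
  then have "y = (\<Sum>e\<in>D. c e *\<^sub>R e)"
    by (simp add: z_def)
  also have "\<dots> \<in> range i"
    using Di by (intro subspace_sum subspace_scale subspace_range) blast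
  finally show "y \<in> range i" .
qed

lemma range_eq_Y:
  assumes "finite B" "span B = (UNIV :: 'a set)"
  shows "range i = Y"
proof
  show "range i \<subseteq> Y"
    using range_i by auto
  show "Y \<subseteq> range i"
  proof
    fix y assume "y \<in> Y"
    then obtain p q where "p \<in> C" "q \<in> C" "y = p - q"
      using Y_generated by blast
    then show "y \<in> range i"
      using C_subset_range[OF assms] subspace_diff[OF subspace_range] by blast
  qed
qed

lemma vector_lattice_if_surj:
  assumes "range i = Y"
  shows "vector_lattice UNIV K"
  unfolding vector_lattice_def
proof (intro conjI ballI ordered)
  have le: "cone_le K a b \<longleftrightarrow> cone_le C (i a) (i b)" for a b
    by (simp add: cone_le_def bipositive flip: linear_diff[OF i_linear])
  fix x y :: 'a
  obtain m where "is_infimum Y C {i x, i y} m"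
    using lattice range_i by (fastforce simp: vector_lattice_def)
  moreover from this obtain a where "m = i a"
    using assms by (auto simp: is_infimum_def)
  ultimately show "\<exists>m. is_infimum UNIV K {x, y} m"
    using range_i by (auto simp: is_infimum_def le)
  obtain s where "is_supremum Y C {i x, i y} s"
    using lattice range_i by (fastforce simp: vector_lattice_def)
  moreover from this obtain b where "s = i b"
    using assms by (auto simp: is_supremum_def)
  ultimately show "\<exists>m. is_supremum UNIV K {x, y} m"
    using range_i by (auto simp: is_supremum_def le)
qed

end

section \<open>The characterization\<close>

lemma pervasive_cover_self:
  fixes K :: "'a::real_vector set"
  assumes "vector_lattice UNIV K"
  shows "pervasive_cover K UNIV K id"
proof -
  have "0 \<in> K"
    using assms by (auto simp: vector_lattice_def ordered_vector_space_def)
  then have "order_dense UNIV K UNIV"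
    by (auto simp: order_dense_def is_infimum_def cone_le_def)
  then show ?thesis
    using assms \<open>0 \<in> K\<close>
    by (auto simp: pervasive_cover_def vector_lattice_cover_def cone_le_def intro: linear_id)
qed

theorem theorem38:
  fixes K :: "'a::real_vector set" and n :: nat
  assumes "\<exists>B :: 'a set. finite B \<and> independent B \<and> span B = UNIV \<and> card B = n"
    and "archimedean UNIV K"
    and "pre_riesz K"
  shows "pervasive_space K \<longleftrightarrow> vector_lattice UNIV K"
proof
  assume "pervasive_space K"
  then obtain Y :: "('a set \<Rightarrow>\<^sub>0 real) set" and C i
    where "ordered_vector_space UNIV K" "pervasive_cover K Y C i"
    by (auto simp: pervasive_space_def)
  then interpret pervasive_archimedean_cover K Y C i
    using assms(2) by unfold_locales
  show "vector_lattice UNIV K"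
    using assms(1) range_eq_Y vector_lattice_if_surj by blast
next
  assume "vector_lattice UNIV K"
  then show "pervasive_space K"
    using pervasive_spaceI pervasive_cover_self vector_lattice_def by blast
qed

end
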